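(* There is an absolute constant $c>0$ such that the following holds (this is the meaning of $\Omega(\cdot)$ below). For any positive integers $n,u$ with $n \cdot 2^{\sqrt{\log n}} \le u \le 2^{n^{n^2+n}}$, and for any (possibly randomized) monotone minimal perfect hash function algorithm $\mathbf{D}(n,u)$ for size-$n$ subsets of $[u]$, \[ d(n,u) = \Omega(n \log\log\log u). \]
   Context: Logarithms are base 2 and $[t]=\{1,\dots,t\}$. Let $\mathcal{S}_{n,u}$ be the family of all $n$-element subsets of $[u]$. A monotone minimal perfect hash function (MMPHF) algorithm $\mathbf{D}(n,u)$ is a (possibly randomized) procedure that, given $S=\{s_1<\dots<s_n\}\in\mathcal{S}_{n,u}$ and a random string $r$ (independent of $S$), produces a binary string (index) $\mathbf{D}^r(S)$ such that for every choice of $r$, the query $\textsc{Rank}(q)$ can be answered from $\mathbf{D}^r(S)$ and $r$ alone, with answer equal to the rank $i$ of $q=s_i$ in $S$ whenever $q\in S$ (any answer is allowed when $q\notin S$). The random bits are available for free (not charged to the index), and computation time is unbounded. Write $d^r(S)$ for the length in bits of $\mathbf{D}^r(S)$, and define $d(n,u):=\max_{S\in\mathcal{S}_{n,u}} \mathbb{E}_r[d^r(S)]$. A deterministic MMPHF is a randomized one ignoring $r$. *)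

theory Defs
  imports "HOL-Probability.Probability"
begin

definition n_subsets :: "nat \<Rightarrow> nat \<Rightarrow> nat set set" where
  "n_subsets n u = {S. S \<subseteq> {1..u} \<and> card S = n}"

definition rank_in :: "nat set \<Rightarrow> nat \<Rightarrow> nat" where
  "rank_in S q = card {s \<in> S. s \<le> q}"

text \<open>
  The random string is a sample of an arbitrary probability space \<open>M\<close>, and \<open>D r S\<close> is the index.
  The query procedure sees only the string, the index and the query; it is an arbitrary function
  since computation is unbounded, and it must be correct for every outcome, not just almost surely.
  Measurability of the index length is what makes its expectation meaningful.
\<close>

definition mmphf :: "'r measure \<Rightarrow> nat \<Rightarrow> nat \<Rightarrow> ('r \<Rightarrow> nat set \<Rightarrow> bool list) \<Rightarrow> bool" where
  "mmphf M n u D \<longleftrightarrow>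
     prob_space M \<and>
     (\<forall>S \<in> n_subsets n u. (\<lambda>r. length (D r S)) \<in> measurable M (count_space UNIV)) \<and>
     (\<exists>Rank :: 'r \<Rightarrow> bool list \<Rightarrow> nat \<Rightarrow> nat.
        \<forall>r \<in> space M. \<forall>S \<in> n_subsets n u. \<forall>q \<in> S. Rank r (D r S) q = rank_in S q)"

text \<open>
  The expectation is taken in \<open>ennreal\<close>, so that an infinite expected length counts as infinite
  rather than as 0.
\<close>

definition mmphf_size :: "'r measure \<Rightarrow> nat \<Rightarrow> nat \<Rightarrow> ('r \<Rightarrow> nat set \<Rightarrow> bool list) \<Rightarrow> ennreal" where
  "mmphf_size M n u D =
     Max ((\<lambda>S. \<integral>\<^sup>+ r. of_nat (length (D r S)) \<partial>M) ` n_subsets n u)"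

end

theory Submission
  imports Defs
begin

text \<open>
  A fixed index together with the random string determines a colouring \<open>f\<close> of the universe, and
  it serves a set \<open>S\<close> only if \<open>f\<close> gives every element of \<open>S\<close> its rank. So it suffices to find a
  distribution on the \<open>n\<close>-subsets under which every colouring succeeds with probability
  \<open>2\<^bsup>- \<Omega>(n log log log u)\<^esup>\<close>: too few short strings exist to serve more than half of the mass.

  View \<open>{0..<k\<^sup>d}\<close> as the leaves of a \<open>k\<close>-ary tree of depth \<open>d\<close>, pick a uniformly random level and
  a random node on it, and draw one uniform leaf below each of its \<open>k\<close> children. The mean square of
  the colour densities lies in \<open>[0, 1]\<close> and increases from each level to the next one towards the
  leaves by exactly the variance of the densities among siblings, so on a random level this variance
  is on average at most \<open>1 / d\<close>. Up to a small error all children thus have the colour densities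
  \<open>p\<^sub>1, \<dots>, p\<^sub>k\<close> of their parent, and the colouring succeeds with probability about
  \<open>p\<^sub>1 \<cdots> p\<^sub>k \<le> k\<^bsup>-k\<^esup>\<close>; the depth \<open>d = k\<^bsup>2k+2\<^esup>\<close> makes the error equally small. Concatenating \<open>n div k\<close>
  independent copies, for the largest \<open>k\<close> that fits, gives the bound.
\<close>

section \<open>Block sums and elementary inequalities\<close>

lemma sum_atLeastLessThan_blocks:
  fixes f :: "nat \<Rightarrow> 'a::comm_monoid_add"
  shows "(\<Sum>y\<in>{A..<A + k * m}. f y) = (\<Sum>i<k. \<Sum>y\<in>{A + i * m..<A + i * m + m}. f y)"
proof (induction k)
  case (Suc k)
  have "(\<Sum>y\<in>{A..<A + Suc k * m}. f y)
      = (\<Sum>y\<in>{A..<A + k * m}. f y) + (\<Sum>y\<in>{A + k * m..<A + Suc k * m}. f y)"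
    by (rule sum.atLeastLessThan_concat[symmetric]) auto
  then show ?case
    using Suc by (simp add: algebra_simps)
qed simp

lemma sum_lessThan_mult:
  fixes f :: "nat \<Rightarrow> 'a::comm_monoid_add"
  shows "(\<Sum>b<m * k. f b) = (\<Sum>a<m. \<Sum>i<k. f (a * k + i))"
proof -
  have "(\<Sum>b<m * k. f b) = (\<Sum>a<m. \<Sum>y\<in>{a * k..<a * k + k}. f y)"
    using sum_atLeastLessThan_blocks[of f 0 m k] by (simp add: atLeast0LessThan)
  also have "\<dots> = (\<Sum>a<m. \<Sum>i<k. f (a * k + i))"
  proof (rule sum.cong[OF refl])
    fix a
    show "(\<Sum>y\<in>{a * k..<a * k + k}. f y) = (\<Sum>i<k. f (a * k + i))"
      by (rule sum.reindex_bij_witness[of _ "\<lambda>i. a * k + i" "\<lambda>y. y - a * k"]) auto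
  qed
  finally show ?thesis .
qed

lemma sum_square_deviation:
  fixes q :: "nat \<Rightarrow> real"
  assumes "k > 0"
  defines "m \<equiv> (\<Sum>i<k. q i) / real k"
  shows "(\<Sum>i<k. (q i - m)\<^sup>2) = (\<Sum>i<k. (q i)\<^sup>2) - real k * m\<^sup>2"
proof -
  have s: "(\<Sum>i<k. q i) = real k * m"
    using assms by simp
  have "(\<Sum>i<k. (q i - m)\<^sup>2) = (\<Sum>i<k. (q i)\<^sup>2 - 2 * m * q i + m\<^sup>2)"
    by (simp add: power2_eq_square algebra_simps)
  also have "\<dots> = (\<Sum>i<k. (q i)\<^sup>2) - 2 * m * (\<Sum>i<k. q i) + real k * m\<^sup>2"
    by (simp add: sum.distrib sum_subtractf sum_distrib_left)
  finally show ?thesis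
    unfolding s by (simp add: power2_eq_square)
qed

lemma prod_le_power_of_sum_le_one:
  fixes p :: "nat \<Rightarrow> real"
  assumes "k > 0" "\<And>i. i < k \<Longrightarrow> 0 \<le> p i" "(\<Sum>i<k. p i) \<le> 1"
  shows "(\<Prod>i<k. p i) \<le> 1 / real k ^ k"
proof -
  \<comment> \<open>\<open>y \<le> exp (y - 1)\<close> for \<open>y = k p\<^sub>i\<close> replaces the AM-GM inequality\<close>
  have "(\<Prod>i<k. p i) \<le> (\<Prod>i<k. exp (real k * p i - 1) / real k)"
  proof (rule prod_mono)
    fix i assume "i \<in> {..<k}"
    moreover have "real k * p i \<le> exp (real k * p i - 1)"
      using exp_ge_add_one_self[of "real k * p i - 1"] by simp
    ultimately show "0 \<le> p i \<and> p i \<le> exp (real k * p i - 1) / real k"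
      using assms by (simp add: field_simps)
  qed
  also have "\<dots> = exp (real k * (\<Sum>i<k. p i) - real k) / real k ^ k"
    by (simp add: prod_dividef exp_sum[symmetric] sum_subtractf sum_distrib_left)
  also have "\<dots> \<le> 1 / real k ^ k"
    using assms by (intro divide_right_mono) (auto simp: mult_left_le)
  finally show ?thesis .
qed

section \<open>Colour densities and their energy on the tree\<close>

text \<open>Heights \<open>h\<close> count from the leaves; node \<open>a\<close> at height \<open>h\<close> has the children \<open>a * k + i\<close>, \<open>i < k\<close>.\<close>

definition color_density :: "(nat \<Rightarrow> nat) \<Rightarrow> nat \<Rightarrow> nat \<Rightarrow> nat \<Rightarrow> nat \<Rightarrow> real" where
  "color_density g k h a c = (\<Sum>y\<in>{a * k ^ h..<a * k ^ h + k ^ h}. of_bool (g y = c)) / real k ^ h"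

text \<open>The potential of an energy increment argument; \<open>k ^ (d - h)\<close> is the number
  of nodes at height \<open>h\<close> in a tree of depth \<open>d\<close>.\<close>

definition energy :: "(nat \<Rightarrow> nat) \<Rightarrow> nat \<Rightarrow> nat \<Rightarrow> nat \<Rightarrow> real" where
  "energy g k d h = (\<Sum>a<k ^ (d - h). \<Sum>c<k. (color_density g k h a c)\<^sup>2) / real k ^ (d - h)"

lemma color_density_nonneg: "0 \<le> color_density g k h a c"
  by (simp add: color_density_def sum_nonneg)

text \<open>Leaves with a colour outside \<open>{..<k}\<close> are not counted, hence only an
  inequality.\<close>

lemma sum_color_density_le_1:
  assumes "k > 0"
  shows "(\<Sum>c<k. color_density g k h a c) \<le> 1"
proof -
  have "(\<Sum>c<k. color_density g k h a c)
      = (\<Sum>y\<in>{a * k ^ h..<a * k ^ h + k ^ h}. \<Sum>c<k. of_bool (g y = c)) / real k ^ h"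
    by (subst sum.swap) (simp add: color_density_def sum_divide_distrib)
  also have "\<dots> \<le> (\<Sum>y\<in>{a * k ^ h..<a * k ^ h + k ^ h}. 1) / real k ^ h"
  proof (intro divide_right_mono sum_mono)
    fix y show "(\<Sum>c<k. of_bool (g y = c)) \<le> (1::real)"
      by (simp add: of_bool_def)
  qed simp
  also have "\<dots> = 1"
    using assms by simp
  finally show ?thesis .
qed

lemma color_density_le_1:
  assumes "c < k"
  shows "color_density g k h a c \<le> 1"
proof -
  have "color_density g k h a c \<le> (\<Sum>c<k. color_density g k h a c)"
    using assms by (intro member_le_sum) (auto simp: color_density_nonneg)
  also have "\<dots> \<le> 1"
    using assms by (intro sum_color_density_le_1) simp
  finally show ?thesis .
qed

lemma color_density_Suc:
  "color_density g k (Suc h) a c = (\<Sum>i<k. color_density g k h (a * k + i) c) / real k"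
  using sum_atLeastLessThan_blocks[of "\<lambda>y. of_bool (g y = c) :: real" "a * k ^ Suc h" k "k ^ h"]
  by (simp add: color_density_def sum_divide_distrib[symmetric] algebra_simps)

lemma energy_nonneg: "0 \<le> energy g k d h"
  by (simp add: energy_def sum_nonneg)

lemma energy_le_1:
  assumes "k > 0"
  shows "energy g k d h \<le> 1"
proof -
  have "(\<Sum>c<k. (color_density g k h a c)\<^sup>2) \<le> 1" for a
  proof -
    have "(\<Sum>c<k. (color_density g k h a c)\<^sup>2) \<le> (\<Sum>c<k. color_density g k h a c)"
      by (intro sum_mono) (auto simp: power2_eq_square intro!: mult_left_le color_density_nonneg color_density_le_1)
    then show ?thesis
      using sum_color_density_le_1[OF assms] by (rule order_trans)
  qed
  then have "energy g k d h \<le> (\<Sum>a<k ^ (d - h). 1) / real k ^ (d - h)"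
    unfolding energy_def by (intro divide_right_mono sum_mono) auto
  also have "\<dots> = 1"
    using assms by simp
  finally show ?thesis .
qed

text \<open>The density of a parent is the mean of those of its children, so
  \<open>sum_square_deviation\<close> applies colour by colour. The divisor is the number of all
  nodes at height \<open>h\<close>.\<close>

lemma energy_decrement:
  assumes "k > 0" "h < d"
  shows "(\<Sum>a<k ^ (d - Suc h). \<Sum>i<k. \<Sum>c<k.
            (color_density g k h (a * k + i) c - color_density g k (Suc h) a c)\<^sup>2) / real k ^ (d - h)
       = energy g k d h - energy g k d (Suc h)"
proof -
  have dh: "d - h = Suc (d - Suc h)"
    using assms by simp
  have "(\<Sum>i<k. \<Sum>c<k. (color_density g k h (a * k + i) c - color_density g k (Suc h) a c)\<^sup>2)
      = (\<Sum>i<k. \<Sum>c<k. (color_density g k h (a * k + i) c)\<^sup>2)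
        - real k * (\<Sum>c<k. (color_density g k (Suc h) a c)\<^sup>2)" for a
  proof -
    have "(\<Sum>i<k. \<Sum>c<k. (color_density g k h (a * k + i) c - color_density g k (Suc h) a c)\<^sup>2)
        = (\<Sum>c<k. \<Sum>i<k. (color_density g k h (a * k + i) c - color_density g k (Suc h) a c)\<^sup>2)"
      by (rule sum.swap)
    also have "\<dots> = (\<Sum>c<k. (\<Sum>i<k. (color_density g k h (a * k + i) c)\<^sup>2)
                        - real k * (color_density g k (Suc h) a c)\<^sup>2)"
      unfolding color_density_Suc using assms by (intro sum.cong refl sum_square_deviation) auto
    also have "\<dots> = (\<Sum>c<k. \<Sum>i<k. (color_density g k h (a * k + i) c)\<^sup>2)
                    - real k * (\<Sum>c<k. (color_density g k (Suc h) a c)\<^sup>2)"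
      by (simp add: sum_subtractf sum_distrib_left)
    finally show ?thesis
      by (subst sum.swap)
  qed
  then have "(\<Sum>a<k ^ (d - Suc h). \<Sum>i<k. \<Sum>c<k.
            (color_density g k h (a * k + i) c - color_density g k (Suc h) a c)\<^sup>2)
      = (\<Sum>b<k ^ (d - h). \<Sum>c<k. (color_density g k h b c)\<^sup>2)
        - real k * (\<Sum>a<k ^ (d - Suc h). \<Sum>c<k. (color_density g k (Suc h) a c)\<^sup>2)"
    unfolding dh power_Suc2 sum_lessThan_mult by (simp add: sum_subtractf sum_distrib_left)
  then show ?thesis
    using assms unfolding energy_def dh by (simp add: field_simps)
qed

text \<open>For factors in [0, 1], passing from the child densities to the parent densities changes
  the product by at most the sum of the deviations. Each squared deviation is enlarged to a sum over
  all colours, which is what the energy controls; \<open>t\<close> stays free to balance the two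
  errors.\<close>

lemma node_success_le:
  fixes t :: real
  assumes "k > 0" "t > 0"
  shows "(\<Prod>i<k. color_density g k h (a * k + i) i)
       \<le> 1 / real k ^ k + real k / t
         + t * (\<Sum>i<k. \<Sum>c<k. (color_density g k h (a * k + i) c - color_density g k (Suc h) a c)\<^sup>2)"
proof -
  let ?p = "\<lambda>i. color_density g k (Suc h) a i" and ?q = "\<lambda>i. color_density g k h (a * k + i) i"
  have "\<bar>(\<Prod>i<k. ?q i) - (\<Prod>i<k. ?p i)\<bar> \<le> (\<Sum>i<k. \<bar>?q i - ?p i\<bar>)"
    using norm_prod_diff[of "{..<k}" ?q ?p] by (auto simp: color_density_nonneg color_density_le_1)
  also have "\<dots> \<le> (\<Sum>i<k. 1 / t + t * (\<Sum>c<k. (color_density g k h (a * k + i) c - ?p c)\<^sup>2))"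
  proof (rule sum_mono)
    fix i assume i: "i \<in> {..<k}"
    \<comment> \<open>a linear deviation is traded for a square one: \<open>x \<le> 1 / t + t x\<^sup>2\<close>\<close>
    define x where "x = \<bar>?q i - ?p i\<bar>"
    have "0 \<le> (t * x - 1)\<^sup>2 + t * x"
      using assms by (intro add_nonneg_nonneg mult_nonneg_nonneg) (auto simp: x_def)
    then have "t * x \<le> t * (1 / t + t * x\<^sup>2)"
      using assms by (simp add: power2_eq_square algebra_simps)
    then have "x \<le> 1 / t + t * x\<^sup>2"
      using assms by simp
    moreover have "x\<^sup>2 \<le> (\<Sum>c<k. (color_density g k h (a * k + i) c - ?p c)\<^sup>2)"
      unfolding x_def using i
      by (auto intro: member_le_sum[where f = "\<lambda>c. (color_density g k h (a * k + i) c - ?p c)\<^sup>2"])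
    ultimately show "x \<le> 1 / t + t * (\<Sum>c<k. (color_density g k h (a * k + i) c - ?p c)\<^sup>2)"
      using assms by (meson add_left_mono mult_left_mono order_trans less_imp_le)
  qed
  finally have "(\<Prod>i<k. ?q i) - (\<Prod>i<k. ?p i)
      \<le> real k / t + t * (\<Sum>i<k. \<Sum>c<k. (color_density g k h (a * k + i) c - ?p c)\<^sup>2)"
    by (simp add: sum.distrib sum_distrib_left)
  moreover have "(\<Prod>i<k. ?p i) \<le> 1 / real k ^ k"
    using assms by (intro prod_le_power_of_sum_le_one sum_color_density_le_1 color_density_nonneg)
  ultimately show ?thesis
    by simp
qed

lemma average_success_le:
  fixes g :: "nat \<Rightarrow> nat"
  assumes "k > 0"
  defines "d \<equiv> k ^ (2 * k + 2)"
  shows "(\<Sum>h<d. (\<Sum>a<k ^ (d - Suc h). \<Prod>i<k. color_density g k h (a * k + i) i) / real k ^ (d - Suc h))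
           / real d \<le> 3 / real k ^ k"
proof -
  \<comment> \<open>With this \<open>t\<close> the error \<open>real k / t\<close> equals
    \<open>1 / real k ^ k\<close>, and the choice of \<open>d\<close> gives
    \<open>t * real k / real d\<close> the same value.\<close>
  define t where "t = real k ^ (k + 1)"
  have t: "t > 0"
    using assms by (simp add: t_def)
  have level: "(\<Sum>a<k ^ (d - Suc h). \<Prod>i<k. color_density g k h (a * k + i) i) / real k ^ (d - Suc h)
      \<le> 1 / real k ^ k + real k / t + t * real k * (energy g k d h - energy g k d (Suc h))"
    if "h < d" for h
  proof -
    let ?V = "\<lambda>a. \<Sum>i<k. \<Sum>c<k. (color_density g k h (a * k + i) c - color_density g k (Suc h) a c)\<^sup>2"
    let ?N = "real k ^ (d - Suc h)"
    have "(\<Sum>a<k ^ (d - Suc h). \<Prod>i<k. color_density g k h (a * k + i) i) / ?N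
        \<le> (\<Sum>a<k ^ (d - Suc h). 1 / real k ^ k + real k / t + t * ?V a) / ?N"
      using assms t by (intro divide_right_mono sum_mono node_success_le) auto
    also have "\<dots> = (?N * (1 / real k ^ k + real k / t) + t * (\<Sum>a<k ^ (d - Suc h). ?V a)) / ?N"
      by (simp only: sum.distrib sum_distrib_left) (simp add: algebra_simps)
    also have "\<dots> = 1 / real k ^ k + real k / t + t * (\<Sum>a<k ^ (d - Suc h). ?V a) / ?N"
      using assms by (simp add: add_divide_distrib)
    \<comment> \<open>The factor \<open>k\<close> passes from the number of parents to the number of
      children.\<close>
    also have "t * (\<Sum>a<k ^ (d - Suc h). ?V a) / ?N
        = t * real k * ((\<Sum>a<k ^ (d - Suc h). ?V a) / real k ^ (d - h))"
    proof -
      have "d - h = Suc (d - Suc h)"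
        using that by simp
      then show ?thesis
        using assms by simp
    qed
    also have "\<dots> = t * real k * (energy g k d h - energy g k d (Suc h))"
      using assms that by (subst energy_decrement) auto
    finally show ?thesis .
  qed
  have "(\<Sum>h<d. (\<Sum>a<k ^ (d - Suc h). \<Prod>i<k. color_density g k h (a * k + i) i) / real k ^ (d - Suc h))
      \<le> (\<Sum>h<d. 1 / real k ^ k + real k / t + t * real k * (energy g k d h - energy g k d (Suc h)))"
    by (intro sum_mono level) auto
  also have "\<dots> = real d * (1 / real k ^ k + real k / t)
                  + t * real k * (\<Sum>h<d. energy g k d h - energy g k d (Suc h))"
    by (simp only: sum.distrib sum_distrib_left) (simp add: algebra_simps)
  \<comment> \<open>The errors of all \<open>d\<close> levels together are a single difference of
    energies, so division by \<open>d\<close> makes them small.\<close>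
  also have "(\<Sum>h<d. energy g k d h - energy g k d (Suc h)) = energy g k d 0 - energy g k d d"
    by (rule sum_lessThan_telescope')
  also have "t * real k * (energy g k d 0 - energy g k d d) \<le> t * real k * 1"
    using t energy_le_1[OF assms(1), of g d 0] energy_nonneg[of g k d d]
    by (intro mult_left_mono) auto
  finally have "(\<Sum>h<d. (\<Sum>a<k ^ (d - Suc h). \<Prod>i<k. color_density g k h (a * k + i) i) / real k ^ (d - Suc h))
      / real d \<le> (real d * (1 / real k ^ k + real k / t) + t * real k) / real d"
    by (intro divide_right_mono) auto
  also have "\<dots> = 1 / real k ^ k + real k / t + t * real k / real d"
    using assms by (simp add: add_divide_distrib)
  also have "real k / t = 1 / real k ^ k"
    using assms by (simp add: t_def)
  also have "t * real k / real d = 1 / real k ^ k"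
  proof -
    have "real d = t * real k * real k ^ k"
      by (simp add: d_def t_def power_add mult_2)
    then show ?thesis
      using assms t by simp
  qed
  finally show ?thesis
    by (simp add: add_divide_distrib[symmetric])
qed

section \<open>Random leaves of the tree\<close>

lemma prob_bind_pmf_of_set:
  assumes "finite A" "A \<noteq> {}"
  shows "measure_pmf.prob (bind_pmf (pmf_of_set A) f) X
       = (\<Sum>a\<in>A. measure_pmf.prob (f a) X) / real (card A)"
proof -
  have "ennreal (measure_pmf.prob (bind_pmf (pmf_of_set A) f) X)
      = ennreal ((\<Sum>a\<in>A. measure_pmf.prob (f a) X) / real (card A))"
    using assms
    by (simp add: measure_pmf.emeasure_eq_measure[symmetric] nn_integral_pmf_of_set)
       (simp add: measure_pmf.emeasure_eq_measure sum_ennreal sum_nonneg divide_ennreal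
          ennreal_of_nat_eq_real_of_nat card_gt_0_iff)
  then show ?thesis
    by (simp add: sum_nonneg)
qed

text \<open>\<open>h\<close> is the height of the children, so their parent \<open>a\<close> has
  height \<open>Suc h\<close>; 0 is only the dummy value of \<open>Pi_pmf\<close> outside
  \<open>{..<k}\<close>.\<close>

definition tree_pmf :: "nat \<Rightarrow> nat \<Rightarrow> (nat \<Rightarrow> nat) pmf" where
  "tree_pmf k d =
     bind_pmf (pmf_of_set {..<d}) (\<lambda>h.
     bind_pmf (pmf_of_set {..<k ^ (d - Suc h)}) (\<lambda>a.
     Pi_pmf {..<k} 0 (\<lambda>i. pmf_of_set {(a * k + i) * k ^ h..<(a * k + i) * k ^ h + k ^ h})))"

text \<open>The leaves below the children of \<open>a\<close> form disjoint intervals in the order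
  of the children.\<close>

lemma set_tree_pmf:
  assumes "x \<in> set_pmf (tree_pmf k d)" "k > 0" "d > 0"
  shows "\<And>i. i < k \<Longrightarrow> x i < k ^ d" "\<And>i j. i < j \<Longrightarrow> j < k \<Longrightarrow> x i < x j"
proof -
  obtain h a where h: "h < d" and a: "a < k ^ (d - Suc h)"
    and x: "x \<in> set_pmf (Pi_pmf {..<k} 0 (\<lambda>i. pmf_of_set {(a * k + i) * k ^ h..<(a * k + i) * k ^ h + k ^ h}))"
    using assms unfolding tree_pmf_def
    by (auto simp: set_bind_pmf set_pmf_of_set lessThan_empty_iff)
  have ivl: "(a * k + i) * k ^ h \<le> x i" "x i < (a * k + i + 1) * k ^ h" if "i < k" for i
    using x that \<open>k > 0\<close> by (auto simp: set_Pi_pmf PiE_dflt_def set_pmf_of_set)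
  show "x i < k ^ d" if "i < k" for i
  proof -
    have "a * k + i + 1 \<le> (a + 1) * k"
      using that by simp
    also have "\<dots> \<le> k ^ (d - Suc h) * k"
      using a by (intro mult_right_mono) auto
    finally have "(a * k + i + 1) * k ^ h \<le> k ^ (d - Suc h) * k * k ^ h"
      by (rule mult_right_mono) simp
    also have "\<dots> = k ^ (d - Suc h + Suc h)"
      by (simp add: power_add)
    also have "\<dots> = k ^ d"
      using h by simp
    finally show ?thesis
      using ivl[OF that] by simp
  qed
  show "x i < x j" if "i < j" "j < k" for i j
  proof -
    have "x i < (a * k + i + 1) * k ^ h"
      using that by (intro ivl) simp
    also have "\<dots> \<le> (a * k + j) * k ^ h"
      using that by (intro mult_right_mono) auto
    also have "\<dots> \<le> x j"
      using that by (intro ivl)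
    finally show ?thesis .
  qed
qed

text \<open>Given the parent, the draws are independent, and child \<open>i\<close> yields colour
  \<open>i\<close> with probability equal to its density; what remains is the average in
  \<open>average_success_le\<close>.\<close>

lemma prob_tree_pmf_le:
  assumes "k > 0"
  shows "measure_pmf.prob (tree_pmf k (k ^ (2 * k + 2))) {x. \<forall>i<k. g (x i) = i} \<le> 3 / real k ^ k"
proof -
  define d where "d = k ^ (2 * k + 2)"
  have "d > 0"
    using assms by (simp add: d_def)
  have "measure_pmf.prob (pmf_of_set {b * k ^ h..<b * k ^ h + k ^ h}) {y. g y = i}
      = color_density g k h b i" for b h i
    using assms
    by (subst measure_pmf_of_set) (auto simp: color_density_def sum.If_cases of_bool_def Int_def)
  moreover have "{x. \<forall>i<k. g (x i) = i} = Pi {..<k} (\<lambda>i. {y. g y = i})"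
    by auto
  ultimately have "measure_pmf.prob (tree_pmf k d) {x. \<forall>i<k. g (x i) = i}
    = (\<Sum>h<d. (\<Sum>a<k ^ (d - Suc h). \<Prod>i<k. color_density g k h (a * k + i) i) / real k ^ (d - Suc h))
        / real d"
    unfolding tree_pmf_def using assms \<open>d > 0\<close>
    by (simp add: prob_bind_pmf_of_set measure_Pi_pmf_Pi lessThan_empty_iff)
  then show ?thesis
    using average_success_le[OF assms] by (simp add: d_def)
qed

section \<open>The hard distribution on sets\<close>

lemma rank_in_image:
  assumes "\<And>i j. i < j \<Longrightarrow> j < n \<Longrightarrow> s i < s j" and "i < n"
  shows "rank_in (s ` {..<n}) (s i) = Suc i"
proof -
  have less_iff: "s j \<le> s i \<longleftrightarrow> j \<le> i" if "j < n" for j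
    using assms that by (metis le_less linorder_not_less)
  then have "{x \<in> s ` {..<n}. x \<le> s i} = s ` {..i}"
    using assms(2) by fastforce
  moreover have "inj_on s {..i}"
    using assms by (intro linorder_inj_onI) (auto, fastforce)
  ultimately show ?thesis
    by (simp add: rank_in_def card_image)
qed

text \<open>\<open>m\<close> blocks of length \<open>U\<close>, of which block \<open>b\<close> contributes the \<open>k\<close> elements of \<open>X b\<close>, followed by
  consecutive numbers that pad the sequence to any desired length.\<close>

definition block_seq :: "nat \<Rightarrow> nat \<Rightarrow> nat \<Rightarrow> (nat \<Rightarrow> nat \<Rightarrow> nat) \<Rightarrow> nat \<Rightarrow> nat" where
  "block_seq k U m X t =
     (if t < m * k then Suc (t div k * U + X (t div k) (t mod k)) else Suc (m * U + (t - m * k)))"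

lemma block_seq_mono:
  assumes "k > 0"
    and bound: "\<And>b i. b < m \<Longrightarrow> i < k \<Longrightarrow> X b i < U"
    and mono: "\<And>b i j. b < m \<Longrightarrow> i < j \<Longrightarrow> j < k \<Longrightarrow> X b i < X b j"
    and "t < t'"
  shows "block_seq k U m X t < block_seq k U m X t'"
proof -
  have in_block: "t div k * U + X (t div k) (t mod k) < (t div k + 1) * U" if "t < m * k" for t
    using that assms(1) by (simp add: bound less_mult_imp_div_less)
  \<comment> \<open>Both indices in the blocks, on either side of the border to the padding, or both
    in the padding.\<close>
  consider "t' < m * k" | "t < m * k" "m * k \<le> t'" | "m * k \<le> t"
    using \<open>t < t'\<close> by linarith
  then show ?thesis
  proof cases
    case 1
    then have div: "t < m * k" "t' div k < m"
      using \<open>t < t'\<close> assms(1) by (auto simp: less_mult_imp_div_less)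
    show ?thesis
    proof (cases "t div k = t' div k")
      case True
      then have "t mod k < t' mod k"
        using \<open>t < t'\<close> by (metis div_mult_mod_eq nat_add_left_cancel_less)
      then show ?thesis
        using 1 div True assms(1) mono by (simp add: block_seq_def)
    next
      case False
      then have "t div k + 1 \<le> t' div k"
        using div_le_mono[of t t' k] \<open>t < t'\<close> by linarith
      then have "(t div k + 1) * U \<le> t' div k * U"
        by (rule mult_right_mono) simp
      then show ?thesis
        using in_block[OF div(1)] 1 div by (simp add: block_seq_def)
    qed
  next
    case 2
    then have "t div k + 1 \<le> m"
      by (simp add: Suc_leI less_mult_imp_div_less)
    then have "(t div k + 1) * U \<le> m * U"
      by (rule mult_right_mono) simp
    then show ?thesis
      using in_block[OF 2(1)] 2 by (simp add: block_seq_def)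
  next
    case 3
    then show ?thesis
      using \<open>t < t'\<close> by (simp add: block_seq_def)
  qed
qed

text \<open>A colouring that is correct on the whole set is correct in each of the
  \<open>n div k\<close> independent blocks, so the bounds multiply.\<close>

lemma ex_hard_distribution:
  assumes "2 \<le> k" "k \<le> n" "n * k ^ (k ^ (2 * k + 2)) \<le> u"
  shows "\<exists>P. set_pmf P \<subseteq> n_subsets n u \<and>
           (\<forall>f. measure_pmf.prob P {S. \<forall>q\<in>S. f q = rank_in S q} \<le> (3 / real k ^ k) ^ (n div k))"
proof -
  define d where "d = k ^ (2 * k + 2)"
  define U where "U = k ^ d"
  define m where "m = n div k"
  define Q where "Q = Pi_pmf {..<m} (\<lambda>_. 0) (\<lambda>_. tree_pmf k d)"
  define s where "s = block_seq k U m"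
  have "d > 0"
    using assms by (simp add: d_def)
  have supp: "X b i < U" "i < j \<Longrightarrow> j < k \<Longrightarrow> X b i < X b j"
    if "X \<in> set_pmf Q" "b < m" "i < k" for X b i j
    using that set_tree_pmf[of "X b" k d] assms \<open>d > 0\<close>
    by (auto simp: Q_def U_def set_Pi_pmf PiE_dflt_def)
  have smono: "s X t < s X t'" if "X \<in> set_pmf Q" "t < t'" for X t t'
    unfolding s_def using assms that supp(1)[OF that(1)] supp(2)[OF that(1)]
    by (intro block_seq_mono) auto
  have sub: "s X ` {..<n} \<in> n_subsets n u" if X: "X \<in> set_pmf Q" for X
  proof -
    have "inj_on (s X) {..<n}"
      using smono[OF X] by (intro linorder_inj_onI) (auto, fastforce)
    moreover have "s X ` {..<n} \<subseteq> {1..u}"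
    proof safe
      fix t assume "t < n"
      have "m * k \<le> n" "n - m * k = n mod k"
        by (simp_all add: m_def minus_div_mult_eq_mod)
      \<comment> \<open>The sequence is strictly increasing, so its value at \<open>n\<close>, one
        past the last index used, bounds all elements.\<close>
      then have "s X t \<le> m * U + n mod k"
        using smono[OF X \<open>t < n\<close>] by (simp add: s_def block_seq_def[of k U m X n])
      also have "\<dots> \<le> m * U + n mod k * U"
        using assms by (simp add: U_def)
      also have "\<dots> \<le> (m * k + n mod k) * U"
        using assms by (simp add: algebra_simps)
      also have "\<dots> \<le> u"
        using assms by (simp add: m_def U_def d_def)
      finally show "s X t \<in> {1..u}"
        by (simp add: s_def block_seq_def)
    qed
    ultimately show ?thesis
      by (simp add: n_subsets_def card_image)
  qed
  have prob: "measure_pmf.prob (map_pmf (\<lambda>X. s X ` {..<n}) Q) {S. \<forall>q\<in>S. f q = rank_in S q}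
      \<le> (3 / real k ^ k) ^ m" for f
  proof -
    \<comment> \<open>The colouring that \<open>f\<close> induces on block \<open>b\<close>, with
      positions and ranks shifted to start at 0. Where \<open>f\<close> is correct, the subtraction
      does not truncate.\<close>
    define g where "g b y = f (Suc (b * U + y)) - Suc (b * k)" for b y
    have "g b (X b i) = i" if X: "X \<in> set_pmf Q" and "b < m" "i < k"
      and f: "\<forall>q\<in>s X ` {..<n}. f q = rank_in (s X ` {..<n}) q" for X b i
    proof -
      have "b * k + i < (b + 1) * k"
        using that by simp
      also have "\<dots> \<le> m * k"
        using that by (intro mult_right_mono) auto
      finally have t: "b * k + i < m * k" .
      also have "\<dots> \<le> n"
        by (simp add: m_def)
      finally have "f (s X (b * k + i)) = Suc (b * k + i)"
        using f rank_in_image[of n "s X" "b * k + i"] smono[OF X] by simp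
      moreover have "s X (b * k + i) = Suc (b * U + X b i)"
        using t that by (simp add: s_def block_seq_def)
      ultimately show ?thesis
        by (simp add: g_def)
    qed
    \<comment> \<open>The inclusion of events is known only on the support of \<open>Q\<close>,
      hence monotonicity almost everywhere.\<close>
    then have "measure_pmf.prob (map_pmf (\<lambda>X. s X ` {..<n}) Q) {S. \<forall>q\<in>S. f q = rank_in S q}
        \<le> measure_pmf.prob Q (Pi {..<m} (\<lambda>b. {x. \<forall>i<k. g b (x i) = i}))"
      unfolding measure_map_pmf
      by (intro measure_pmf.finite_measure_mono_AE) (auto simp: AE_measure_pmf_iff)
    also have "\<dots> = (\<Prod>b<m. measure_pmf.prob (tree_pmf k d) {x. \<forall>i<k. g b (x i) = i})"
      unfolding Q_def by (simp add: measure_Pi_pmf_Pi)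
    also have "\<dots> \<le> (\<Prod>b<m. 3 / real k ^ k)"
      unfolding d_def using assms
      by (intro prod_mono conjI measure_nonneg prob_tree_pmf_le) simp
    finally show ?thesis
      by simp
  qed
  show ?thesis
    using sub prob by (intro exI[of _ "map_pmf (\<lambda>X. s X ` {..<n}) Q"]) (auto simp: m_def)
qed

section \<open>From success probability to index length\<close>

lemma finite_card_bool_lists_less:
  "finite {xs :: bool list. length xs < L} \<and> card {xs :: bool list. length xs < L} = 2 ^ L - 1"
proof (induction L)
  case (Suc L)
  have eq: "{xs :: bool list. length xs < Suc L}
      = {xs. length xs < L} \<union> {xs. set xs \<subseteq> UNIV \<and> length xs = L}"
    by auto
  have "card {xs :: bool list. set xs \<subseteq> UNIV \<and> length xs = L} = 2 ^ L"
    by (subst card_lists_length_eq) auto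
  moreover have "finite {xs :: bool list. set xs \<subseteq> UNIV \<and> length xs = L}"
    by (intro finite_lists_length_eq) simp
  ultimately show ?case
    unfolding eq using Suc by (subst card_Un_disjoint) auto
qed simp

lemma finite_n_subsets: "finite (n_subsets n u)"
  by (rule finite_subset[of _ "Pow {1..u}"]) (auto simp: n_subsets_def)

text \<open>The \<open>2 ^ L - 1\<close> strings shorter than \<open>L\<close> carry mass at most
  \<open>p\<close> each, so at least half of the mass has length at least \<open>L\<close>; Markov's
  inequality does the rest.\<close>

lemma average_length_ge:
  fixes enc :: "'a \<Rightarrow> bool list"
  assumes "finite (set_pmf P)"
    and "\<And>xs. measure_pmf.prob P {S. enc S = xs} \<le> p" and "(2 ^ L - 1) * p \<le> 1 / 2"
  shows "real L / 2 \<le> (\<Sum>S\<in>set_pmf P. pmf P S * real (length (enc S)))"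
proof -
  have "{S. length (enc S) < L} = (\<Union>xs\<in>{xs. length xs < L}. {S. enc S = xs})"
    by auto
  then have "measure_pmf.prob P {S. length (enc S) < L}
      \<le> (\<Sum>xs\<in>{xs. length xs < L}. measure_pmf.prob P {S. enc S = xs})"
    using finite_card_bool_lists_less by (auto intro!: measure_pmf.finite_measure_subadditive_finite)
  also have "\<dots> \<le> (\<Sum>xs\<in>{xs::bool list. length xs < L}. p)"
    by (intro sum_mono assms)
  also have "\<dots> = (2 ^ L - 1) * p"
    using finite_card_bool_lists_less[of L] by (simp add: of_nat_diff)
  finally have "measure_pmf.prob P {S. length (enc S) < L} \<le> 1 / 2"
    using assms by simp
  moreover have "{S. L \<le> length (enc S)} = space P - {S. length (enc S) < L}"
    by auto
  ultimately have "1 / 2 \<le> measure_pmf.prob P {S. L \<le> length (enc S)}"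
    using measure_pmf.prob_compl[of "{S. length (enc S) < L}" P] by simp
  then have "real L / 2 \<le> real L * measure_pmf.prob P {S. L \<le> length (enc S)}"
    using mult_left_mono[of "1 / 2" "measure_pmf.prob P {S. L \<le> length (enc S)}" "real L"] by simp
  also have "\<dots> = real L * (\<Sum>S\<in>set_pmf P \<inter> {S. L \<le> length (enc S)}. pmf P S)"
    using assms(1)
    by (subst measure_Int_set_pmf[symmetric]) (simp add: measure_measure_pmf_finite Int_commute)
  also have "\<dots> = (\<Sum>S\<in>set_pmf P \<inter> {S. L \<le> length (enc S)}. pmf P S * real L)"
    by (simp add: sum_distrib_left mult.commute)
  also have "\<dots> \<le> (\<Sum>S\<in>set_pmf P \<inter> {S. L \<le> length (enc S)}. pmf P S * real (length (enc S)))"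
    by (intro sum_mono mult_left_mono) auto
  also have "\<dots> \<le> (\<Sum>S\<in>set_pmf P. pmf P S * real (length (enc S)))"
    using assms(1) by (intro sum_mono2) auto
  finally show ?thesis .
qed

text \<open>The easy direction of Yao's principle: the maximum over sets is at least the average
  under \<open>P\<close>, and after exchanging sum and integral each outcome \<open>r\<close> is a
  deterministic scheme.\<close>

lemma mmphf_size_ge:
  assumes mm: "mmphf M n u D"
    and supp: "set_pmf P \<subseteq> n_subsets n u"
    and prob: "\<And>f. measure_pmf.prob P {S. \<forall>q\<in>S. f q = rank_in S q} \<le> p"
    and L: "(2 ^ L - 1) * p \<le> 1 / 2"
  shows "ennreal (real L / 2) \<le> mmphf_size M n u D"
proof -
  interpret prob_space M
    using mm by (simp add: mmphf_def)
  obtain Rank where Rank: "\<And>r S q. r \<in> space M \<Longrightarrow> S \<in> n_subsets n u \<Longrightarrow> q \<in> S \<Longrightarrow>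
      Rank r (D r S) q = rank_in S q"
    using mm unfolding mmphf_def by blast
  have meas: "(\<lambda>r. of_nat (length (D r S)) :: ennreal) \<in> borel_measurable M" if "S \<in> n_subsets n u" for S
  proof -
    have "(\<lambda>r. length (D r S)) \<in> measurable M (count_space UNIV)"
      using mm that by (simp add: mmphf_def)
    then show ?thesis
      by (rule measurable_compose) simp
  qed
  have fin: "finite (set_pmf P)"
    using supp finite_n_subsets by (rule finite_subset)
  have avg: "ennreal (real L / 2) \<le> (\<Sum>S\<in>set_pmf P. ennreal (pmf P S) * of_nat (length (D r S)))"
    if r: "r \<in> space M" for r
  proof -
    \<comment> \<open>For fixed \<open>r\<close> and \<open>xs\<close>, \<open>Rank r xs\<close> is
      a single colouring that is correct on every set of the support with index
      \<open>xs\<close>.\<close>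
    have "measure_pmf.prob P {S. D r S = xs} \<le> p" for xs
    proof -
      have "measure_pmf.prob P {S. D r S = xs}
          \<le> measure_pmf.prob P {S. \<forall>q\<in>S. Rank r xs q = rank_in S q}"
        using Rank[OF r] supp
        by (intro measure_pmf.finite_measure_mono_AE) (auto simp: AE_measure_pmf_iff)
      also have "\<dots> \<le> p"
        by (rule prob)
      finally show ?thesis .
    qed
    then have "real L / 2 \<le> (\<Sum>S\<in>set_pmf P. pmf P S * real (length (D r S)))"
      using fin L by (intro average_length_ge) auto
    then have "ennreal (real L / 2) \<le> ennreal (\<Sum>S\<in>set_pmf P. pmf P S * real (length (D r S)))"
      by (rule ennreal_leI)
    then show ?thesis
      by (simp add: sum_ennreal[symmetric] ennreal_mult ennreal_of_nat_eq_real_of_nat)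
  qed
  have "ennreal (real L / 2) = (\<integral>\<^sup>+ r. ennreal (real L / 2) \<partial>M)"
    by (simp add: emeasure_space_1)
  also have "\<dots> \<le> (\<integral>\<^sup>+ r. (\<Sum>S\<in>set_pmf P. ennreal (pmf P S) * of_nat (length (D r S))) \<partial>M)"
    by (intro nn_integral_mono avg)
  also have "\<dots> = (\<Sum>S\<in>set_pmf P. ennreal (pmf P S) * (\<integral>\<^sup>+ r. of_nat (length (D r S)) \<partial>M))"
    using supp meas by (subst nn_integral_sum) (auto intro!: sum.cong nn_integral_cmult)
  also have "\<dots> \<le> (\<Sum>S\<in>set_pmf P. ennreal (pmf P S) * mmphf_size M n u D)"
    using supp finite_n_subsets unfolding mmphf_size_def
    by (intro sum_mono mult_left_mono Max_ge) auto
  also have "\<dots> = mmphf_size M n u D"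
    using fin by (simp add: sum_distrib_right[symmetric] sum_ennreal sum_pmf_eq_1)
  finally show ?thesis .
qed

text \<open>The element 2 has rank 2 in \<open>{1..n}\<close> but rank 1 in
  \<open>{2..Suc n}\<close>, so no colouring serves both sets. This covers bounded
  \<open>n\<close>.\<close>

lemma mmphf_size_ge_half:
  assumes "mmphf M n u D" "2 \<le> n" "n < u"
  shows "ennreal (1 / 2) \<le> mmphf_size M n u D"
proof -
  define A where "A = {{1..n}, {2..Suc n}}"
  have ne: "{1..n} \<noteq> {2..Suc n}"
    using assms by (simp add: atLeastatMost_subset_iff set_eq_subset)
  have "measure_pmf.prob (pmf_of_set A) {S. \<forall>q\<in>S. f q = rank_in S q} \<le> 1 / 2" for f
  proof -
    have "{s. 1 \<le> s \<and> s \<le> n \<and> s \<le> 2} = {1, 2}" "{s. 2 \<le> s \<and> s \<le> Suc n \<and> s \<le> 2} = {2::nat}"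
      using assms by auto
    then have rank: "rank_in {1..n} 2 = 2" "rank_in {2..Suc n} 2 = 1"
      by (simp_all add: rank_in_def conj_assoc)
    have "\<not> A \<subseteq> {S. \<forall>q\<in>S. f q = rank_in S q}"
    proof
      assume "A \<subseteq> {S. \<forall>q\<in>S. f q = rank_in S q}"
      then have "\<forall>q\<in>{1..n}. f q = rank_in {1..n} q" "\<forall>q\<in>{2..Suc n}. f q = rank_in {2..Suc n} q"
        by (auto simp: A_def)
      moreover have "2 \<in> {1..n}" "2 \<in> {2..Suc n}"
        using assms by auto
      ultimately have "f 2 = rank_in {1..n} 2" "f 2 = rank_in {2..Suc n} 2"
        by blast+
      then show False
        using rank by simp
    qed
    then have "card (A \<inter> {S. \<forall>q\<in>S. f q = rank_in S q}) < card A"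
      by (intro psubset_card_mono) (auto simp: A_def)
    then show ?thesis
      using ne by (subst measure_pmf_of_set) (auto simp: A_def)
  qed
  moreover have "set_pmf (pmf_of_set A) \<subseteq> n_subsets n u"
    using assms by (subst set_pmf_of_set) (auto simp: A_def n_subsets_def)
  \<comment> \<open>With \<open>L = 1\<close> only the empty string is short.\<close>
  ultimately show ?thesis
    using mmphf_size_ge[OF assms(1), of "pmf_of_set A" "1 / 2" 1] by simp
qed

text \<open>The success probability is at most 2 to the power \<open>- (l * real n / 4)\<close>;
  half of that exponent serves as the length \<open>L\<close>, which leaves enough room for the
  factor 1/2.\<close>

lemma mmphf_size_ge_log:
  assumes "mmphf M n u D" "8 \<le> k" "k \<le> n" "n * k ^ (k ^ (2 * k + 2)) \<le> u"
  shows "ennreal (real n * log 2 (real k) / 32) \<le> mmphf_size M n u D"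
proof -
  define l where "l = log 2 (real k)"
  define L where "L = nat \<lfloor>l * real n / 8\<rfloor>"
  define p where "p = (3 / real k ^ k) ^ (n div k)"
  have k: "real k = 2 powr l"
    using assms by (simp add: l_def)
  have l: "3 \<le> l"
    unfolding l_def using assms by (subst le_log_iff) auto
  have "3 * 8 \<le> l * real n"
    using assms l by (intro mult_mono) auto
  then have ln: "24 \<le> l * real n"
    by simp
  have p_le: "p \<le> 2 powr (- (l * real n / 4))"
  proof -
    \<comment> \<open>Rounding in \<open>n div k\<close> costs at most a factor 2, since
      \<open>k \<le> n\<close>.\<close>
    have "n \<le> 2 * k * (n div k)"
    proof -
      have "n mod k < k" "k * 1 \<le> k * (n div k)"
        using assms by (auto intro!: mult_le_mono simp: Suc_le_eq div_greater_zero_iff)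
      then show ?thesis
        using mult_div_mod_eq[of k n] by linarith
    qed
    then have "real n \<le> 2 * real k * real (n div k)"
      by (metis of_nat_le_iff of_nat_mult of_nat_numeral)
    also have "2 * real k * real (n div k) \<le> 4 * (real k - 1) * real (n div k)"
      using assms by (intro mult_right_mono) auto
    finally have exponent: "l * (real n / 4) \<le> l * ((real k - 1) * real (n div k))"
      using l by (intro mult_left_mono) (auto simp: algebra_simps)
    \<comment> \<open>The constant 3 is absorbed into one factor \<open>k\<close>.\<close>
    have "3 / real k ^ k \<le> real k / real k ^ k"
      using assms by (intro divide_right_mono) auto
    also have "\<dots> = real k powr (1 - real k)"
      using assms by (simp add: powr_diff powr_realpow)
    finally have "p \<le> (real k powr (1 - real k)) ^ (n div k)"
      unfolding p_def by (intro power_mono) auto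
    also have "\<dots> = 2 powr (- (l * ((real k - 1) * real (n div k))))"
      using assms unfolding k by (simp add: powr_powr powr_realpow[symmetric] algebra_simps)
    also have "\<dots> \<le> 2 powr (- (l * real n / 4))"
      using exponent by (intro powr_mono) auto
    finally show ?thesis .
  qed
  have "(2 ^ L - 1) * p \<le> 2 powr (l * real n / 8) * 2 powr (- (l * real n / 4))"
  proof (intro mult_mono p_le)
    have "real L \<le> l * real n / 8"
      using ln unfolding L_def by linarith
    then have "(2::real) powr real L \<le> 2 powr (l * real n / 8)"
      by (intro powr_mono) auto
    then show "(2::real) ^ L - 1 \<le> 2 powr (l * real n / 8)"
      by (simp add: powr_realpow)
  qed (auto simp: p_def)
  also have "\<dots> = 2 powr (- (l * real n / 8))"
    by (simp add: powr_add[symmetric])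
  also have "\<dots> \<le> 2 powr (- 1)"
    using ln by (intro powr_mono) auto
  finally have "(2 ^ L - 1) * p \<le> 1 / 2"
    by (simp add: powr_minus_divide)
  then have "ennreal (real L / 2) \<le> mmphf_size M n u D"
    using ex_hard_distribution[of k n u] assms mmphf_size_ge[OF assms(1), of _ p L]
    unfolding p_def by auto
  \<comment> \<open>The floor costs at most half of \<open>l * real n / 8\<close>, which is at least
    3.\<close>
  moreover have "l * real n / 8 - 1 \<le> real L"
    using ln unfolding L_def by linarith
  then have "real n * l / 32 \<le> real L / 2"
    using ln by (simp add: mult.commute)
  ultimately show ?thesis
    unfolding l_def by (meson ennreal_leI order_trans)
qed

section \<open>Block size and iterated logarithms\<close>

text \<open>The size 1 always qualifies, so a largest one exists; it is stopped either by
  \<open>n\<close> or by \<open>u\<close>.\<close>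

lemma ex_max_block_size:
  fixes n u :: nat
  assumes "1 \<le> n" "n \<le> u"
  shows "\<exists>k. 1 \<le> k \<and> k \<le> n \<and> n * k ^ (k ^ (2 * k + 2)) \<le> u \<and>
           (k = n \<or> u < n * Suc k ^ (Suc k ^ (2 * Suc k + 2)))"
proof -
  define A where "A = {k. 1 \<le> k \<and> k \<le> n \<and> n * k ^ (k ^ (2 * k + 2)) \<le> u}"
  have "finite A" "1 \<in> A"
    using assms by (auto simp: A_def)
  then have "Max A \<in> A" "Suc (Max A) \<notin> A"
    by (auto intro: Max_in dest: Max_ge)
  then show ?thesis
    by (intro exI[of _ "Max A"]) (auto simp: A_def not_le not_less_eq_eq)
qed

text \<open>From \<open>u \<ge> 2 * n \<ge> 4\<close>. The bounds keep the iterated logarithm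
  nonnegative and its arguments positive.\<close>

lemma log_log_bounds:
  fixes n u :: nat
  assumes "2 \<le> n" "real n * 2 powr sqrt (log 2 (real n)) \<le> real u"
  shows "2 \<le> log 2 (real u)" "1 \<le> log 2 (log 2 (real u))" "n < u"
proof -
  have n: "1 \<le> log 2 (real n)"
    using assms by simp
  then have "2 powr 1 \<le> 2 powr sqrt (log 2 (real n))"
    by (intro powr_mono) auto
  then have "real n * 2 \<le> real n * 2 powr sqrt (log 2 (real n))"
    by (intro mult_left_mono) auto
  then have nu: "real n * 2 \<le> real u"
    using assms(2) by (rule order_trans)
  then show "n < u"
    using assms by linarith
  have "2 powr 2 \<le> real u"
    using nu assms by simp
  then show u: "2 \<le> log 2 (real u)"
    using nu assms by (subst le_log_iff) auto
  then show "1 \<le> log 2 (log 2 (real u))"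
    by simp
qed

text \<open>For the case that \<open>n\<close> stops the block size: here the upper bound on
  \<open>u\<close> makes a single block of size \<open>n\<close> good enough.\<close>

lemma logloglog_le_of_power_bound:
  fixes n u :: nat
  assumes "2 \<le> n" "1 \<le> log 2 (log 2 (real u))" "2 \<le> log 2 (real u)"
    and "u \<le> 2 ^ (n ^ (n ^ 2 + n))"
  shows "log 2 (log 2 (log 2 (real u))) \<le> 4 * log 2 (real n)"
proof -
  have ln: "log 2 (real n) \<le> real n"
    using assms log2_of_power_le[of n n] less_exp[of n] by simp
  have "real u > 0"
    using assms(3) by (cases "u = 0") (auto simp: log_def)
  then have "log 2 (real u) \<le> real (n ^ (n\<^sup>2 + n))"
    using assms by (intro log2_of_power_le) auto
  then have "log 2 (log 2 (real u)) \<le> log 2 (real n ^ (n\<^sup>2 + n))"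
    using assms by (subst log_le_cancel_iff) auto
  also have "\<dots> = (real n ^ 2 + real n) * log 2 (real n)"
    using assms by (simp add: log_nat_power)
  also have "\<dots> \<le> (real n ^ 2 + real n) * real n"
    using ln by (intro mult_left_mono) auto
  also have "\<dots> \<le> (real n ^ 2 + real n ^ 2) * real n"
    using assms by (intro mult_right_mono add_left_mono) (auto simp: power2_eq_square)
  also have "\<dots> = 2 * real n ^ 3"
    by (simp add: power2_eq_square power3_eq_cube)
  also have "\<dots> \<le> real n * real n ^ 3"
    using assms by (intro mult_right_mono) auto
  also have "\<dots> = real n ^ 4"
    by (simp add: eval_nat_numeral)
  finally have "log 2 (log 2 (log 2 (real u))) \<le> log 2 (real n ^ 4)"
    using assms by (subst log_le_cancel_iff) auto
  then show ?thesis
    using assms by (simp add: log_nat_power)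
qed

text \<open>Maximality only bounds \<open>u / n\<close>. The lower bound on \<open>u\<close> gives
  \<open>log 2 n \<le> x\<^sup>2\<close> for \<open>x = log 2 (u / n)\<close>, so
  \<open>log 2 u \<le> x + x\<^sup>2\<close> is bounded too.\<close>

lemma log_le_of_maximal:
  fixes n u K :: nat
  assumes "2 \<le> n" "2 \<le> K"
    and "real n * 2 powr sqrt (log 2 (real n)) \<le> real u"
    and "u < n * K ^ (K ^ (2 * K + 2))"
  shows "log 2 (real u) \<le> real K ^ (4 * K + 7)"
proof -
  define x where "x = log 2 (real u / real n)"
  define y where "y = real K ^ (2 * K + 3)"
  have "u > 0"
    using log_log_bounds[OF assms(1,3)] by simp
  have ln: "0 \<le> log 2 (real n)"
    using assms by simp
  have lK: "log 2 (real K) \<le> real K"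
    using assms log2_of_power_le[of K K] less_exp[of K] by simp
  have "2 powr sqrt (log 2 (real n)) \<le> real u / real n"
    using assms by (simp add: field_simps)
  then have "sqrt (log 2 (real n)) \<le> x"
    unfolding x_def using \<open>u > 0\<close> assms by (subst le_log_iff) auto
  then have nx: "log 2 (real n) \<le> x\<^sup>2"
    using sqrt_le_D by blast
  have x0: "0 \<le> x"
    using \<open>sqrt (log 2 (real n)) \<le> x\<close> ln real_sqrt_ge_zero order_trans by blast
  have "real u < real (n * K ^ (K ^ (2 * K + 2)))"
    using assms(4) by (simp only: of_nat_less_iff)
  then have "real u / real n < real K ^ (K ^ (2 * K + 2))"
    using assms by (simp add: field_simps)
  then have "x \<le> log 2 (real K ^ (K ^ (2 * K + 2)))"
    unfolding x_def using \<open>u > 0\<close> assms by (subst log_le_cancel_iff) auto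
  also have "\<dots> = real K ^ (2 * K + 2) * log 2 (real K)"
    using assms by (simp add: log_nat_power)
  also have "\<dots> \<le> real K ^ (2 * K + 2) * real K"
    using lK by (intro mult_left_mono) auto
  also have "\<dots> = y"
    by (simp add: y_def eval_nat_numeral)
  finally have xy: "x \<le> y" .
  have "1 \<le> y"
    unfolding y_def using assms by (intro one_le_power) auto
  have "log 2 (real u) = x + log 2 (real n)"
    using \<open>u > 0\<close> assms by (simp add: x_def log_divide)
  also have "\<dots> \<le> y + y\<^sup>2"
    using nx xy power_mono[OF xy x0, of 2] by linarith
  also have "\<dots> \<le> 2 * y\<^sup>2"
    using \<open>1 \<le> y\<close> by (simp add: power2_eq_square)
  also have "\<dots> \<le> real K * y\<^sup>2"
    using assms by (intro mult_right_mono) auto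
  also have "\<dots> = real K ^ (1 + (2 * K + 3) * 2)"
    by (simp only: y_def power_mult power_add power_one_right)
  also have "1 + (2 * K + 3) * 2 = 4 * K + 7"
    by simp
  finally show ?thesis .
qed

lemma logloglog_le_of_log_le:
  fixes u K :: nat
  assumes "2 \<le> K" "1 \<le> log 2 (log 2 (real u))" "2 \<le> log 2 (real u)"
    and "log 2 (real u) \<le> real K ^ (4 * K + 7)"
  shows "log 2 (log 2 (log 2 (real u))) \<le> 5 * log 2 (real K)"
proof -
  have lK: "log 2 (real K) \<le> real K"
    using assms log2_of_power_le[of K K] less_exp[of K] by simp
  have "log 2 (log 2 (real u)) \<le> log 2 (real K ^ (4 * K + 7))"
    using assms by (subst log_le_cancel_iff) auto
  also have "\<dots> = (4 * real K + 7) * log 2 (real K)"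
    using assms by (simp add: log_nat_power)
  \<comment> \<open>\<open>4 * K + 7 \<le> 8 * K\<close> holds from \<open>K = 2\<close> on.\<close>
  also have "\<dots> \<le> (2 ^ 3 * real K) * real K"
    using lK assms by (intro mult_mono) auto
  also have "\<dots> \<le> (real K ^ 3 * real K) * real K"
    using assms by (intro mult_right_mono power_mono) auto
  also have "\<dots> = real K ^ 5"
    by (simp add: eval_nat_numeral)
  finally have "log 2 (log 2 (log 2 (real u))) \<le> log 2 (real K ^ 5)"
    using assms by (subst log_le_cancel_iff) auto
  then show ?thesis
    using assms by (simp add: log_nat_power)
qed

section \<open>Choice of the absolute constant\<close>

theorem theorem1:
  shows "\<exists>c::real. c > 0 \<and>
    (\<forall>(n::nat) (u::nat) (M :: (nat \<Rightarrow> bool) measure) (D :: (nat \<Rightarrow> bool) \<Rightarrow> nat set \<Rightarrow> bool list).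
       n \<ge> 1 \<longrightarrow> u \<ge> 1 \<longrightarrow>
       real n * 2 powr sqrt (log 2 (real n)) \<le> real u \<longrightarrow>
       u \<le> 2 ^ (n ^ (n ^ 2 + n)) \<longrightarrow>
       mmphf M n u D \<longrightarrow>
       ennreal (c * real n * log 2 (log 2 (log 2 (real u)))) \<le> mmphf_size M n u D)"
proof -
  \<comment> \<open>\<open>N\<close> bounds \<open>n\<close> whenever the maximal block size is below 8: then \<open>log 2 u \<le> 8 ^ (4 * 8 + 7)\<close>\<close>
  define E :: real where "E = 8 ^ 39"
  define N where "N = 8 + 2 powr E"
  \<comment> \<open>For \<open>k \<ge> 8\<close>, 320 is 10 times 32, from
    \<open>l \<le> 10 * log 2 k\<close> and \<open>mmphf_size_ge_log\<close>; for smaller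
    \<open>k\<close>, \<open>l \<le> 15\<close> and \<open>n \<le> N\<close> meet the bound
    1/2.\<close>
  define c where "c = min (1 / 320) (1 / (30 * N))"
  have N: "8 \<le> N"
    by (simp add: N_def)
  have c: "0 < c" "c \<le> 1 / 320" "c \<le> 1 / (30 * N)"
    using N by (auto simp: c_def)
  have "ennreal (c * real n * log 2 (log 2 (log 2 (real u)))) \<le> mmphf_size M n u D"
    if "1 \<le> n" "1 \<le> u" and lower: "real n * 2 powr sqrt (log 2 (real n)) \<le> real u"
      and upper: "u \<le> 2 ^ (n ^ (n ^ 2 + n))" and mm: "mmphf M n u D"
    for n u :: nat and M :: "(nat \<Rightarrow> bool) measure" and D
  proof (cases "n = 1")
    case True
    then have "u = 1 \<or> u = 2"
      using upper that by auto
    \<comment> \<open>the iterated logarithm is 0 here because \<open>ln 0 = 0\<close>\<close>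
    then show ?thesis
      by (auto simp: log_def)
  next
    case False
    then have n: "2 \<le> n"
      using that by simp
    note lu = log_log_bounds[OF n lower]
    define l where "l = log 2 (log 2 (log 2 (real u)))"
    have l0: "0 \<le> l"
      using lu by (simp add: l_def)
    obtain k where k: "1 \<le> k" "k \<le> n" "n * k ^ (k ^ (2 * k + 2)) \<le> u"
      and max: "k = n \<or> u < n * Suc k ^ (Suc k ^ (2 * Suc k + 2))"
      using ex_max_block_size[OF \<open>1 \<le> n\<close> less_imp_le[OF lu(3)]] by blast
    have max': "k = n \<and> l \<le> 4 * log 2 (real k) \<or>
        l \<le> 5 * log 2 (real (Suc k)) \<and> log 2 (real u) \<le> real (Suc k) ^ (4 * Suc k + 7)"
      using max
    proof
      assume "k = n"
      then show ?thesis
        using logloglog_le_of_power_bound[OF n lu(2,1) upper] by (simp add: l_def)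
    next
      assume "u < n * Suc k ^ (Suc k ^ (2 * Suc k + 2))"
      then have "log 2 (real u) \<le> real (Suc k) ^ (4 * Suc k + 7)"
        using n k lower by (intro log_le_of_maximal) auto
      then show ?thesis
        using logloglog_le_of_log_le[OF _ lu(2,1), of "Suc k"] k by (simp add: l_def)
    qed
    show ?thesis
    proof (cases "8 \<le> k")
      case True
      \<comment> \<open>Maximality speaks of \<open>Suc k\<close>, the lower bound of
        \<open>k\<close>; squaring bridges the gap at the cost of a factor 2.\<close>
      have "log 2 (real (Suc k)) \<le> log 2 (real k ^ 2)"
      proof (subst log_le_cancel_iff)
        have "real (Suc k) \<le> 2 * real k"
          using k by simp
        also have "\<dots> \<le> real k * real k"
          using True by (intro mult_right_mono) auto
        finally show "real (Suc k) \<le> real k ^ 2"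
          by (simp add: power2_eq_square)
      qed (use k in auto)
      then have "log 2 (real (Suc k)) \<le> 2 * log 2 (real k)"
        using k by (simp add: log_nat_power)
      moreover have "0 \<le> log 2 (real k)"
        using k by simp
      ultimately have "l \<le> 10 * log 2 (real k)"
        using max' by linarith
      then have "c * (real n * l) \<le> 1 / 320 * (real n * (10 * log 2 (real k)))"
        using c l0 by (intro mult_mono) auto
      then have "c * real n * l \<le> real n * log 2 (real k) / 32"
        by simp
      then show ?thesis
        using mmphf_size_ge_log[OF mm True k(2,3)] unfolding l_def
        by (meson ennreal_leI order_trans)
    next
      case False
      have lk: "log 2 (real i) \<le> 3" if "i \<le> 8" "1 \<le> i" for i
        using that by (subst log_le_iff) auto
      have "l \<le> 15"
        using max' lk[of k] lk[of "Suc k"] False k by auto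
      \<comment> \<open>If \<open>k = n\<close>, then \<open>n < 8\<close>; otherwise
        \<open>u\<close>, and with it \<open>n\<close>, is at most \<open>2 powr E\<close>.\<close>
      moreover have "real n \<le> N"
        using max'
      proof
        assume "l \<le> 5 * log 2 (real (Suc k)) \<and> log 2 (real u) \<le> real (Suc k) ^ (4 * Suc k + 7)"
        then have "log 2 (real u) \<le> real (Suc k) ^ (4 * Suc k + 7)" ..
        also have "\<dots> \<le> real (Suc k) ^ 39"
          using False by (intro power_increasing) auto
        also have "\<dots> \<le> E"
          unfolding E_def using False by (intro power_mono) auto
        finally have "real u \<le> 2 powr E"
          using that by (subst (asm) log_le_iff) auto
        then show ?thesis
          using lu(3) by (simp add: N_def)
      qed (use False N in auto)
      ultimately have "c * (real n * l) \<le> 1 / (30 * N) * (N * 15)"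
        using c N l0 by (intro mult_mono) auto
      also have "\<dots> = 1 / 2"
        using N by simp
      finally have "c * real n * l \<le> 1 / 2"
        by (simp add: mult.assoc)
      then show ?thesis
        using mmphf_size_ge_half[OF mm n lu(3)] unfolding l_def
        by (meson ennreal_leI order_trans)
    qed
  qed
  then show ?thesis
    using c(1) by (intro exI[of _ c]) blast
qed

end
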